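(* There is a substitution basis for the class $\mathcal{E}$ of Kalmár elementary functions that consists of one binary operation only; that is, there exists a binary operation $h:\mathbb{N}^2\to\mathbb{N}$ such that $\langle h\rangle=\mathcal{E}$.
   Context: $\mathbb{N}$ is the set of non-negative integers. An ($r$-ary, $r\ge 1$) operation on $\mathbb{N}$ is a function $\mathbb{N}^r\to\mathbb{N}$. Truncated subtraction is $x \mathbin{\dot-} y:=\max(x-y,0)$. A set $S$ of operations on $\mathbb{N}$ is closed under substitution if, whenever $f\in S$ is $r$-ary and $g_1,\dots,g_r\in S$ are $n$-ary, the operation $\vec x\mapsto f(g_1(\vec x),\dots,g_r(\vec x))$ is in $S$. For a set $\mathcal{B}$ of operations on $\mathbb{N}$, $\langle\mathcal{B}\rangle$ denotes the closure under substitution of $\mathcal{B}\cup C\cup P$, where $C$ is the set of all constant operations on $\mathbb{N}$ (of every arity) and $P$ is the set of all projections $(x_1,\dots,x_n)\mapsto x_i$; $\langle h\rangle$ means $\langle\{h\}\rangle$. A set $\mathcal{B}$ is a substitution basis for a set $G$ of operations if $\langle\mathcal{B}\rangle=G$. The Kalmár elementary functions, forming the class $\mathcal{E}$, are the elements of the smallest set of operations on $\mathbb{N}$ that contains the constants, the projections, the addition, and the truncated subtraction, and that is closed under substitution, bounded summation ($(\vec x,y)\mapsto\sum_{z<y}f(\vec x,z)$), and bounded multiplication ($(\vec x,y)\mapsto\prod_{z<y}f(\vec x,z)$). *)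

theory Defs
  imports "HOL.Hull" "HOL-Library.FuncSet"
begin

text \<open>
  An operation is a pair of its arity and a function on argument lists. The function is
  \<^const>\<open>undefined\<close> off the lists of the right length, so that equality of pairs is equality of
  operations and sets of operations can be compared with ordinary set equality.
\<close>

type_synonym operation = "nat \<times> (nat list \<Rightarrow> nat)"

definition tuples :: "nat \<Rightarrow> nat list set" where
  "tuples n = {xs. length xs = n}"

definition operations :: "operation set" where
  "operations = (SIGMA r:{1..}. tuples r \<rightarrow>\<^sub>E UNIV)"

definition op_of :: "nat \<Rightarrow> (nat list \<Rightarrow> nat) \<Rightarrow> operation" where
  "op_of n f = (n, restrict f (tuples n))"

definition binary_op :: "(nat \<Rightarrow> nat \<Rightarrow> nat) \<Rightarrow> operation" where
  "binary_op h = op_of 2 (\<lambda>xs. h (xs ! 0) (xs ! 1))"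

definition constant_ops :: "operation set" where
  "constant_ops = {op_of n (\<lambda>_. c) | n c. 1 \<le> n}"

definition projection_ops :: "operation set" where
  "projection_ops = {op_of n (\<lambda>xs. xs ! i) | n i. i < n}"

definition closed_under_substitution :: "operation set \<Rightarrow> bool" where
  "closed_under_substitution S \<longleftrightarrow>
     (\<forall>r f n gs. (r, f) \<in> S \<and> length gs = r \<and> (\<forall>g\<in>set gs. (n, g) \<in> S) \<longrightarrow>
        op_of n (\<lambda>xs. f (map (\<lambda>g. g xs) gs)) \<in> S)"

text \<open>
  The last argument plays the role of the bound; the list of the remaining ones may be empty.
\<close>

definition closed_under_bounded_sum :: "operation set \<Rightarrow> bool" where
  "closed_under_bounded_sum S \<longleftrightarrow>
     (\<forall>n f. (Suc n, f) \<in> S \<longrightarrow>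
        op_of (Suc n) (\<lambda>xs. \<Sum>z<last xs. f (butlast xs @ [z])) \<in> S)"

definition closed_under_bounded_prod :: "operation set \<Rightarrow> bool" where
  "closed_under_bounded_prod S \<longleftrightarrow>
     (\<forall>n f. (Suc n, f) \<in> S \<longrightarrow>
        op_of (Suc n) (\<lambda>xs. \<Prod>z<last xs. f (butlast xs @ [z])) \<in> S)"

definition substitution_closure :: "operation set \<Rightarrow> operation set" where
  "substitution_closure B = closed_under_substitution hull (B \<union> constant_ops \<union> projection_ops)"

definition substitution_basis :: "operation set \<Rightarrow> operation set \<Rightarrow> bool" where
  "substitution_basis B G \<longleftrightarrow> B \<subseteq> operations \<and> substitution_closure B = G"

text \<open>Subtraction on \<^typ>\<open>nat\<close> is already truncated.\<close>

definition kalmar_elementary :: "operation set" where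
  "kalmar_elementary =
     (\<lambda>S. closed_under_substitution S \<and> closed_under_bounded_sum S \<and> closed_under_bounded_prod S)
       hull (constant_ops \<union> projection_ops \<union> {binary_op (\<lambda>x y. x + y), binary_op (\<lambda>x y. x - y)})"

text \<open>
  The hulls range over arbitrary sets of pairs, including pairs that do not represent operations;
  the following facts show that this is harmless.
\<close>

lemma op_of_in_operations: "1 \<le> n \<Longrightarrow> op_of n f \<in> operations"
  by (auto simp: operations_def op_of_def)

lemma binary_op_in_operations: "binary_op h \<in> operations"
  by (simp add: binary_op_def op_of_in_operations)

lemma constant_ops_subset_operations: "constant_ops \<subseteq> operations"
  by (auto simp: constant_ops_def intro!: op_of_in_operations)

lemma projection_ops_subset_operations: "projection_ops \<subseteq> operations"
  by (auto simp: projection_ops_def intro!: op_of_in_operations)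

lemma closed_under_substitution_operations: "closed_under_substitution operations"
  unfolding closed_under_substitution_def
proof (intro allI impI)
  fix r f n and gs :: "(nat list \<Rightarrow> nat) list"
  assume *: "(r, f) \<in> operations \<and> length gs = r \<and> (\<forall>g\<in>set gs. (n, g) \<in> operations)"
  then have "gs \<noteq> []"
    by (auto simp: operations_def)
  with * have "1 \<le> n"
    by (cases gs) (auto simp: operations_def)
  then show "op_of n (\<lambda>xs. f (map (\<lambda>g. g xs) gs)) \<in> operations"
    by (rule op_of_in_operations)
qed

lemma substitution_closure_subset_operations:
  assumes "B \<subseteq> operations"
  shows "substitution_closure B \<subseteq> operations"
  unfolding substitution_closure_def
  using assms constant_ops_subset_operations projection_ops_subset_operations
    closed_under_substitution_operations
  by (intro hull_minimal) auto

lemma kalmar_elementary_subset_operations: "kalmar_elementary \<subseteq> operations"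
  unfolding kalmar_elementary_def
  using constant_ops_subset_operations projection_ops_subset_operations
    closed_under_substitution_operations binary_op_in_operations
  by (intro hull_minimal)
    (auto simp: closed_under_bounded_sum_def closed_under_bounded_prod_def
      intro: op_of_in_operations)

lemma closed_under_substitution_Inter:
  assumes "\<And>S. S \<in> F \<Longrightarrow> closed_under_substitution S"
  shows "closed_under_substitution (\<Inter>F)"
  unfolding closed_under_substitution_def
proof (intro allI impI InterI)
  fix r f n gs S
  assume "(r, f) \<in> \<Inter>F \<and> length gs = r \<and> (\<forall>g\<in>set gs. (n, g) \<in> \<Inter>F)" and S: "S \<in> F"
  then have "(r, f) \<in> S \<and> length gs = r \<and> (\<forall>g\<in>set gs. (n, g) \<in> S)"
    by simp
  then show "op_of n (\<lambda>xs. f (map (\<lambda>g. g xs) gs)) \<in> S"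
    using assms[OF S] unfolding closed_under_substitution_def by simp
qed

lemma closed_under_bounded_sum_Inter:
  assumes "\<And>S. S \<in> F \<Longrightarrow> closed_under_bounded_sum S"
  shows "closed_under_bounded_sum (\<Inter>F)"
  using assms unfolding closed_under_bounded_sum_def by simp

lemma closed_under_bounded_prod_Inter:
  assumes "\<And>S. S \<in> F \<Longrightarrow> closed_under_bounded_prod S"
  shows "closed_under_bounded_prod (\<Inter>F)"
  using assms unfolding closed_under_bounded_prod_def by simp

lemma closed_under_substitution_closure: "closed_under_substitution (substitution_closure B)"
  unfolding substitution_closure_def
  by (rule hull_in) (simp add: closed_under_substitution_Inter)

lemma kalmar_elementary_closed:
  "closed_under_substitution kalmar_elementary \<and> closed_under_bounded_sum kalmar_elementary \<and>
   closed_under_bounded_prod kalmar_elementary"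
  unfolding kalmar_elementary_def
  by (rule hull_in)
    (simp add: closed_under_substitution_Inter closed_under_bounded_sum_Inter
      closed_under_bounded_prod_Inter)

end

theory Submission
  imports Defs "HOL-Library.Nat_Bijection"
begin

text \<open>
  Every elementary function becomes, after coding argument lists by iterated pairing, the value
  \<open>ev t\<close> of a term \<open>t\<close> in a small language of unary combinators. That \<open>ev t x = y\<close>
  is witnessed by a finite set of judgements \<open>(t', x', y')\<close> in which each judgement follows
  from others in the set by one evaluation rule. Such a set is coded by the number having its
  elements as binary digits, and being a derivation is an elementary predicate of this number.
  Hence searching for a derivation below a bound \<open>m\<close> is one elementary function
  \<open>universal c x m\<close>, and a fixed number of iterations of a single fast growing elementary
  function \<open>growth\<close> bounds the derivations for a given \<open>t\<close>. So \<open>universal\<close>,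
  \<open>growth\<close> and pairing generate all elementary functions; a case distinction on the first
  argument merges them into one binary operation.
\<close>

subsection \<open>Substitution and the closure properties of the elementary functions\<close>

lemma op_of_cong: "(\<And>xs. length xs = n \<Longrightarrow> f xs = g xs) \<Longrightarrow> op_of n f = op_of n g"
  by (auto simp: op_of_def tuples_def fun_eq_iff)

locale clone =
  fixes S :: "operation set"
  assumes subst: "closed_under_substitution S"
    and const: "constant_ops \<subseteq> S"
    and proj: "projection_ops \<subseteq> S"
begin

lemma op_subst:
  assumes F: "op_of (length Gs) F \<in> S" and Gs: "\<And>G. G \<in> set Gs \<Longrightarrow> op_of n G \<in> S"
  shows "op_of n (\<lambda>xs. F (map (\<lambda>G. G xs) Gs)) \<in> S"
proof -
  let ?gs = "map (\<lambda>G. restrict G (tuples n)) Gs"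
  have "op_of n (\<lambda>xs. restrict F (tuples (length Gs)) (map (\<lambda>g. g xs) ?gs)) \<in> S"
    using F Gs
    by (intro subst[unfolded closed_under_substitution_def, rule_format, of "length Gs"])
      (auto simp: op_of_def simp del: restrict_apply)
  also have "op_of n (\<lambda>xs. restrict F (tuples (length Gs)) (map (\<lambda>g. g xs) ?gs)) =
      op_of n (\<lambda>xs. F (map (\<lambda>G. G xs) Gs))"
    by (rule op_of_cong) (simp add: tuples_def comp_def)
  finally show ?thesis .
qed

lemma op_const: "1 \<le> n \<Longrightarrow> op_of n (\<lambda>_. c) \<in> S"
  using const by (auto simp: constant_ops_def)

lemma op_proj: "i < n \<Longrightarrow> op_of n (\<lambda>xs. xs ! i) \<in> S"
  using proj by (auto simp: projection_ops_def)

lemma op_subst1: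
  assumes "op_of 1 (\<lambda>xs. f (xs ! 0)) \<in> S" "op_of n g \<in> S"
  shows "op_of n (\<lambda>xs. f (g xs)) \<in> S"
  using op_subst[of "[g]" "\<lambda>xs. f (xs ! 0)" n] assms by simp

lemma op_subst2:
  assumes "binary_op f \<in> S" "op_of n g \<in> S" "op_of n h \<in> S"
  shows "op_of n (\<lambda>xs. f (g xs) (h xs)) \<in> S"
  using op_subst[of "[g, h]" "\<lambda>xs. f (xs ! 0) (xs ! 1)" n] assms
  by (auto simp: binary_op_def numeral_2_eq_2)

text \<open>Dummy arguments come from substituting the first \<open>n\<close> of the
  \<open>m\<close> projections.\<close>

lemma op_weaken:
  assumes "op_of n f \<in> S" "n \<le> m"
  shows "op_of m (\<lambda>xs. f (take n xs)) \<in> S"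
proof -
  have "op_of m (\<lambda>xs. f (map (\<lambda>G. G xs) (map (\<lambda>i xs. xs ! i) [0..<n]))) \<in> S"
    by (rule op_subst) (use assms in \<open>auto intro: op_proj\<close>)
  also have "op_of m (\<lambda>xs. f (map (\<lambda>G. G xs) (map (\<lambda>i xs. xs ! i) [0..<n]))) =
      op_of m (\<lambda>xs. f (take n xs))"
    using assms(2) by (intro op_of_cong arg_cong[of _ _ f] nth_equalityI) auto
  finally show ?thesis .
qed

end

lemma clone_substitution_closure: "clone (substitution_closure B)"
  using closed_under_substitution_closure
    hull_subset[of "B \<union> constant_ops \<union> projection_ops" closed_under_substitution]
  by unfold_locales (auto simp: substitution_closure_def)

lemma kalmar_basic:
  "constant_ops \<union> projection_ops \<union> {binary_op (\<lambda>x y. x + y), binary_op (\<lambda>x y. x - y)}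
     \<subseteq> kalmar_elementary"
  unfolding kalmar_elementary_def by (rule hull_subset)

interpretation K: clone kalmar_elementary
  using kalmar_elementary_closed kalmar_basic by unfold_locales auto

lemma op_add:
  "op_of n f \<in> kalmar_elementary \<Longrightarrow> op_of n g \<in> kalmar_elementary \<Longrightarrow>
     op_of n (\<lambda>xs. f xs + g xs) \<in> kalmar_elementary"
  using kalmar_basic by (auto intro: K.op_subst2[of "\<lambda>x y. x + y"])

lemma op_diff:
  "op_of n f \<in> kalmar_elementary \<Longrightarrow> op_of n g \<in> kalmar_elementary \<Longrightarrow>
     op_of n (\<lambda>xs. f xs - g xs) \<in> kalmar_elementary"
  using kalmar_basic by (auto intro: K.op_subst2[of "\<lambda>x y. x - y"])

text \<open>Bounded sums and products arrive with the bound as an extra last argument; this puts an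
  arbitrary elementary bound in its place.\<close>

lemma op_bind_last:
  assumes f: "op_of (Suc n) f \<in> kalmar_elementary" and b: "op_of n b \<in> kalmar_elementary"
  shows "op_of n (\<lambda>xs. f (xs @ [b xs])) \<in> kalmar_elementary"
proof -
  let ?Gs = "map (\<lambda>i xs. xs ! i) [0..<n] @ [b]"
  have "op_of n (\<lambda>xs. f (map (\<lambda>G. G xs) ?Gs)) \<in> kalmar_elementary"
    by (rule K.op_subst) (use f b in \<open>auto intro: K.op_proj\<close>)
  also have "op_of n (\<lambda>xs. f (map (\<lambda>G. G xs) ?Gs)) = op_of n (\<lambda>xs. f (xs @ [b xs]))"
    by (intro op_of_cong arg_cong[of _ _ f]) (auto simp: comp_def map_nth)
  finally show ?thesis .
qed

lemma op_sum:
  assumes b: "op_of n b \<in> kalmar_elementary"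
    and F: "op_of (Suc n) (\<lambda>ys. F (take n ys) (ys ! n)) \<in> kalmar_elementary"
  shows "op_of n (\<lambda>xs. \<Sum>z<b xs. F xs z) \<in> kalmar_elementary"
proof -
  let ?f = "restrict (\<lambda>ys. F (take n ys) (ys ! n)) (tuples (Suc n))"
  have "closed_under_bounded_sum kalmar_elementary"
    using kalmar_elementary_closed by blast
  then have "op_of (Suc n) (\<lambda>xs. \<Sum>z<last xs. ?f (butlast xs @ [z])) \<in> kalmar_elementary"
    using F unfolding closed_under_bounded_sum_def op_of_def by blast
  from op_bind_last[OF this b]
  have "op_of n (\<lambda>xs. \<Sum>z<b xs. ?f (xs @ [z])) \<in> kalmar_elementary"
    by simp
  also have "op_of n (\<lambda>xs. \<Sum>z<b xs. ?f (xs @ [z])) = op_of n (\<lambda>xs. \<Sum>z<b xs. F xs z)"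
    by (rule op_of_cong) (simp add: tuples_def nth_append)
  finally show ?thesis .
qed

lemma op_prod:
  assumes b: "op_of n b \<in> kalmar_elementary"
    and F: "op_of (Suc n) (\<lambda>ys. F (take n ys) (ys ! n)) \<in> kalmar_elementary"
  shows "op_of n (\<lambda>xs. \<Prod>z<b xs. F xs z) \<in> kalmar_elementary"
proof -
  let ?f = "restrict (\<lambda>ys. F (take n ys) (ys ! n)) (tuples (Suc n))"
  have "closed_under_bounded_prod kalmar_elementary"
    using kalmar_elementary_closed by blast
  then have "op_of (Suc n) (\<lambda>xs. \<Prod>z<last xs. ?f (butlast xs @ [z])) \<in> kalmar_elementary"
    using F unfolding closed_under_bounded_prod_def op_of_def by blast
  from op_bind_last[OF this b]
  have "op_of n (\<lambda>xs. \<Prod>z<b xs. ?f (xs @ [z])) \<in> kalmar_elementary"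
    by simp
  also have "op_of n (\<lambda>xs. \<Prod>z<b xs. ?f (xs @ [z])) = op_of n (\<lambda>xs. \<Prod>z<b xs. F xs z)"
    by (rule op_of_cong) (simp add: tuples_def nth_append)
  finally show ?thesis .
qed

lemma op_mult:
  assumes "op_of n f \<in> kalmar_elementary" "op_of n g \<in> kalmar_elementary"
  shows "op_of n (\<lambda>xs. f xs * g xs) \<in> kalmar_elementary"
proof -
  \<comment> \<open>A product is a sum of \<open>g xs\<close> copies of \<open>f xs\<close>, so the
    summand ignores the summation index.\<close>
  have "op_of n (\<lambda>xs. \<Sum>z<g xs. f xs) \<in> kalmar_elementary"
    by (rule op_sum[OF assms(2) K.op_weaken[OF assms(1)]]) simp
  then show ?thesis by (simp add: mult.commute)
qed

section \<open>The Cantor pairing function and its inverses are elementary\<close>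

definition pr :: "nat \<Rightarrow> nat \<Rightarrow> nat" where "pr x y = prod_encode (x, y)"
definition pr1 :: "nat \<Rightarrow> nat" where "pr1 z = fst (prod_decode z)"
definition pr2 :: "nat \<Rightarrow> nat" where "pr2 z = snd (prod_decode z)"

lemma pr_simps [simp]: "pr1 (pr x y) = x" "pr2 (pr x y) = y" "pr (pr1 z) (pr2 z) = z"
  by (simp_all add: pr_def pr1_def pr2_def)

lemma pr_eq_iff [simp]: "pr x y = pr x' y' \<longleftrightarrow> x = x' \<and> y = y'"
  by (simp add: pr_def)

lemma le_pr: "x \<le> pr x y" "y \<le> pr x y"
  by (simp_all add: pr_def le_prod_encode_1 le_prod_encode_2)

lemma pr12_le: "pr1 z \<le> z" "pr2 z \<le> z"
  using le_pr(1)[of "pr1 z" "pr2 z"] le_pr(2)[of "pr2 z" "pr1 z"] by simp_all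

lemma pr_mono: "x \<le> x' \<Longrightarrow> y \<le> y' \<Longrightarrow> pr x y \<le> pr x' y'"
  unfolding pr_def prod_encode_def triangle_def prod.case
  by (intro add_mono div_le_mono mult_le_mono Suc_le_mono[THEN iffD2])

text \<open>The library defines \<open>triangle\<close> by a division; as a bounded sum it is
  visibly elementary.\<close>

lemma triangle_sum: "triangle n = (\<Sum>z<n. z + 1)"
  by (induction n) auto

lemma op_pr:
  assumes "op_of n f \<in> kalmar_elementary" "op_of n g \<in> kalmar_elementary"
  shows "op_of n (\<lambda>xs. pr (f xs) (g xs)) \<in> kalmar_elementary"
  unfolding pr_def prod_encode_def prod.case triangle_sum
  by (intro op_add op_sum assms K.op_proj K.op_const) auto

lemma indicator_eq_nat: "of_bool (x = y) = (1 - (x - y)) * (1 - (y - x) :: nat)" for x y :: nat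
  by auto

text \<open>Decoding is a search written as a sum: exactly one pair is mapped to \<open>z\<close>,
  and both its components are at most \<open>z\<close>, so all other summands vanish.\<close>

lemma pr1_sum: "pr1 z = (\<Sum>x<z + 1. \<Sum>y<z + 1. x * of_bool (pr x y = z))"
proof -
  have "(\<Sum>x<z + 1. \<Sum>y<z + 1. x * of_bool (pr x y = z))
      = (\<Sum>q\<in>{..<z + 1} \<times> {..<z + 1}. fst q * of_bool (pr (fst q) (snd q) = z))"
    unfolding sum.cartesian_product by (simp only: split_def)
  also have "\<dots> = (\<Sum>q\<in>{(pr1 z, pr2 z)}. fst q * of_bool (pr (fst q) (snd q) = z))"
    by (rule sum.mono_neutral_right) (use pr12_le[of z] in \<open>auto simp: less_Suc_eq_le\<close>)
  finally show ?thesis by simp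
qed

lemma pr2_sum: "pr2 z = (\<Sum>x<z + 1. \<Sum>y<z + 1. y * of_bool (pr x y = z))"
proof -
  have "(\<Sum>x<z + 1. \<Sum>y<z + 1. y * of_bool (pr x y = z))
      = (\<Sum>q\<in>{..<z + 1} \<times> {..<z + 1}. snd q * of_bool (pr (fst q) (snd q) = z))"
    unfolding sum.cartesian_product by (simp only: split_def)
  also have "\<dots> = (\<Sum>q\<in>{(pr1 z, pr2 z)}. snd q * of_bool (pr (fst q) (snd q) = z))"
    by (rule sum.mono_neutral_right) (use pr12_le[of z] in \<open>auto simp: less_Suc_eq_le\<close>)
  finally show ?thesis by simp
qed

section \<open>Elementary functions and predicates of one variable\<close>

text \<open>With pairing available, further variables are packed into one argument, so that
  elementarity can be proved by introduction rules following the syntax.\<close>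

definition elementary :: "(nat \<Rightarrow> nat) \<Rightarrow> bool" where
  "elementary f \<longleftrightarrow> op_of 1 (\<lambda>xs. f (xs ! 0)) \<in> kalmar_elementary"

lemma elementary_const: "elementary (\<lambda>_. c)"
  unfolding elementary_def by (rule K.op_const) simp

lemma elementary_id: "elementary (\<lambda>x. x)"
  unfolding elementary_def by (rule K.op_proj) simp

lemma elementary_add: "elementary f \<Longrightarrow> elementary g \<Longrightarrow> elementary (\<lambda>x. f x + g x)"
  unfolding elementary_def by (rule op_add)

lemma elementary_diff: "elementary f \<Longrightarrow> elementary g \<Longrightarrow> elementary (\<lambda>x. f x - g x)"
  unfolding elementary_def by (rule op_diff)

lemma elementary_mult: "elementary f \<Longrightarrow> elementary g \<Longrightarrow> elementary (\<lambda>x. f x * g x)"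
  unfolding elementary_def by (rule op_mult)

lemma elementary_pr: "elementary f \<Longrightarrow> elementary g \<Longrightarrow> elementary (\<lambda>x. pr (f x) (g x))"
  unfolding elementary_def by (rule op_pr)

lemma elementary_comp: "elementary f \<Longrightarrow> elementary g \<Longrightarrow> elementary (\<lambda>x. f (g x))"
  unfolding elementary_def by (rule K.op_subst1)

lemma elementary_pr1: "elementary f \<Longrightarrow> elementary (\<lambda>x. pr1 (f x))"
proof (rule elementary_comp[of pr1])
  show "elementary pr1"
    unfolding elementary_def pr1_sum indicator_eq_nat
    by (intro op_sum op_mult op_add op_diff op_pr K.op_const) (simp_all add: K.op_proj)

qed

lemma elementary_pr2: "elementary f \<Longrightarrow> elementary (\<lambda>x. pr2 (f x))"
proof (rule elementary_comp[of pr2])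
  show "elementary pr2"
    unfolding elementary_def pr2_sum indicator_eq_nat
    by (intro op_sum op_mult op_add op_diff op_pr K.op_const) (simp_all add: K.op_proj)
qed

lemma elementary_curried:
  assumes "elementary (\<lambda>p. F (pr1 p) (pr2 p))"
  shows "binary_op F \<in> kalmar_elementary"
  unfolding binary_op_def
  using K.op_subst1[OF assms[unfolded elementary_def], of 2 "\<lambda>xs. pr (xs ! 0) (xs ! 1)"]
  by (simp add: op_pr K.op_proj)

text \<open>The parameter and the summation index are packed into the single argument
  \<open>p\<close> of the summand.\<close>

lemma elementary_sum:
  assumes "elementary b" "elementary (\<lambda>p. F (pr1 p) (pr2 p))"
  shows "elementary (\<lambda>x. \<Sum>z<b x. F x z)"
  using elementary_curried[OF assms(2)] assms(1)
  unfolding elementary_def binary_op_def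
  by (intro op_sum) (simp_all add: numeral_2_eq_2)

lemma elementary_prod:
  assumes "elementary b" "elementary (\<lambda>p. F (pr1 p) (pr2 p))"
  shows "elementary (\<lambda>x. \<Prod>z<b x. F x z)"
  using elementary_curried[OF assms(2)] assms(1)
  unfolding elementary_def binary_op_def
  by (intro op_prod) (simp_all add: numeral_2_eq_2)

lemma elementary_power:
  assumes "elementary f" "elementary g"
  shows "elementary (\<lambda>x. f x ^ g x)"
proof -
  have "elementary (\<lambda>x. \<Prod>z<g x. f x)"
    by (intro elementary_prod elementary_comp[OF assms(1)] elementary_pr1 elementary_id assms(2))
  then show ?thesis by simp
qed

definition elementary_pred :: "(nat \<Rightarrow> bool) \<Rightarrow> bool" where
  "elementary_pred P \<longleftrightarrow> elementary (\<lambda>x. of_bool (P x))"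

lemma elementary_pred_less:
  assumes "elementary f" "elementary g"
  shows "elementary_pred (\<lambda>x. f x < g x)"
proof -
  \<comment> \<open>\<open>1 - (1 - d)\<close> is the sign of \<open>d\<close>.\<close>
  have "elementary (\<lambda>x. 1 - (1 - (g x - f x)))"
    by (intro elementary_diff elementary_const assms)
  also have "(\<lambda>x. 1 - (1 - (g x - f x))) = (\<lambda>x. of_bool (f x < g x))"
    by auto
  finally show ?thesis by (simp add: elementary_pred_def)
qed

lemma elementary_pred_not:
  assumes "elementary_pred P"
  shows "elementary_pred (\<lambda>x. \<not> P x)"
proof -
  have "elementary (\<lambda>x. 1 - of_bool (P x))"
    using assms unfolding elementary_pred_def by (intro elementary_diff elementary_const)
  also have "(\<lambda>x. 1 - of_bool (P x)) = (\<lambda>x. of_bool (\<not> P x) :: nat)"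
    by auto
  finally show ?thesis by (simp add: elementary_pred_def)
qed

lemma elementary_pred_conj:
  assumes "elementary_pred P" "elementary_pred Q"
  shows "elementary_pred (\<lambda>x. P x \<and> Q x)"
  using elementary_mult assms unfolding elementary_pred_def of_bool_conj by blast

lemma elementary_pred_disj:
  assumes "elementary_pred P" "elementary_pred Q"
  shows "elementary_pred (\<lambda>x. P x \<or> Q x)"
proof -
  have "elementary_pred (\<lambda>x. \<not> (\<not> P x \<and> \<not> Q x))"
    by (intro elementary_pred_not elementary_pred_conj assms)
  then show ?thesis by simp
qed

lemma elementary_pred_imp:
  assumes "elementary_pred P" "elementary_pred Q"
  shows "elementary_pred (\<lambda>x. P x \<longrightarrow> Q x)"
  unfolding imp_conv_disj by (intro elementary_pred_disj elementary_pred_not assms)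

lemma elementary_pred_eq:
  assumes "elementary f" "elementary g"
  shows "elementary_pred (\<lambda>x. f x = g x)"
proof -
  have "elementary_pred (\<lambda>x. \<not> f x < g x \<and> \<not> g x < f x)"
    by (intro elementary_pred_not elementary_pred_conj elementary_pred_less assms)
  also have "(\<lambda>x. \<not> f x < g x \<and> \<not> g x < f x) = (\<lambda>x. f x = g x)"
    by auto
  finally show ?thesis .
qed

lemma elementary_pred_ex:
  assumes "elementary b" "elementary_pred (\<lambda>p. P (pr1 p) (pr2 p))"
  shows "elementary_pred (\<lambda>x. \<exists>z<b x. P x z)"
proof -
  \<comment> \<open>A bounded search succeeds iff the sum of its indicators is positive.\<close>
  have "elementary_pred (\<lambda>x. 0 < (\<Sum>z<b x. of_bool (P x z) :: nat))"
    using assms unfolding elementary_pred_def[of "\<lambda>p. P (pr1 p) (pr2 p)"]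
    by (intro elementary_pred_less elementary_const elementary_sum)
  also have "(\<lambda>x. 0 < (\<Sum>z<b x. of_bool (P x z) :: nat)) = (\<lambda>x. \<exists>z<b x. P x z)"
    by (auto simp: sum_pos2 zero_less_iff_neq_zero)
  finally show ?thesis .
qed

lemma elementary_pred_all:
  assumes "elementary b" "elementary_pred (\<lambda>p. P (pr1 p) (pr2 p))"
  shows "elementary_pred (\<lambda>x. \<forall>z<b x. P x z)"
proof -
  have "elementary_pred (\<lambda>x. \<not> (\<exists>z<b x. \<not> P x z))"
    by (intro elementary_pred_not elementary_pred_ex assms)
  then show ?thesis by simp
qed

lemma elementary_if:
  assumes "elementary_pred P" "elementary f" "elementary g"
  shows "elementary (\<lambda>x. if P x then f x else g x)"
proof -
  have "elementary (\<lambda>x. of_bool (P x) * f x + of_bool (\<not> P x) * g x)"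
    using assms elementary_pred_not[of P]
    unfolding elementary_pred_def by (intro elementary_add elementary_mult)
  also have "(\<lambda>x. of_bool (P x) * f x + of_bool (\<not> P x) * g x) = (\<lambda>x. if P x then f x else g x)"
    by auto
  finally show ?thesis .
qed

section \<open>Membership in a finite set coded by binary digits\<close>

text \<open>Digit \<open>j\<close> of \<open>w\<close> is 1 iff the quotient of \<open>w\<close> by
  \<open>2 ^ j\<close> is odd. Naming quotient and remainder replaces division and parity by bounded
  quantifiers.\<close>

lemma mem_set_decode_iff:
  "j \<in> set_decode w \<longleftrightarrow> (\<exists>q<w + 1. \<exists>r<2 ^ j. w = (2 * q + 1) * 2 ^ j + r)"
proof
  assume "j \<in> set_decode w"
  then have "odd (w div 2 ^ j)" by (simp add: set_decode_def)
  then obtain q where q: "w div 2 ^ j = 2 * q + 1" by (rule oddE)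
  have "q < w + 1" using q div_le_dividend[of w "2 ^ j"] by linarith
  moreover have "w = (2 * q + 1) * 2 ^ j + w mod 2 ^ j"
    using div_mult_mod_eq[of w "2 ^ j"] q by simp
  ultimately show "\<exists>q<w + 1. \<exists>r<2 ^ j. w = (2 * q + 1) * 2 ^ j + r"
    by (metis mod_less_divisor zero_less_numeral zero_less_power)
next
  assume "\<exists>q<w + 1. \<exists>r<2 ^ j. w = (2 * q + 1) * 2 ^ j + r"
  then obtain q r where qr: "r < 2 ^ j" "w = (2 * q + 1) * 2 ^ j + r" by blast
  have "w div 2 ^ j = 2 * q + 1"
    unfolding qr(2) using qr(1) div_mult_self3[of "2 ^ j" "2 * q + 1" r] by simp
  then show "j \<in> set_decode w" by (simp add: set_decode_def)
qed

lemma elementary_pred_mem: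
  assumes "elementary f" "elementary g"
  shows "elementary_pred (\<lambda>x. f x \<in> set_decode (g x))"
  unfolding mem_set_decode_iff
  by (intro elementary_pred_ex elementary_pred_eq elementary_add elementary_mult elementary_power
      elementary_const elementary_pr1 elementary_pr2 elementary_id
      elementary_comp[OF assms(1)] elementary_comp[OF assms(2)] assms)

lemmas elementary_intros =
  elementary_const elementary_id elementary_add elementary_diff elementary_mult elementary_power
  elementary_pr elementary_pr1 elementary_pr2 elementary_sum elementary_if
  elementary_pred_less elementary_pred_not elementary_pred_conj elementary_pred_disj
  elementary_pred_imp elementary_pred_eq elementary_pred_ex elementary_pred_all elementary_pred_mem

subsection \<open>Combinator terms and derivations\<close>

text \<open>Terms act on one number, read as a pair where necessary: \<open>Fork\<close> and
  \<open>Comp\<close> take over the role of substitution, and \<open>Sum\<close> and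
  \<open>Prod\<close> read their argument as parameter and bound.\<close>

datatype expr =
    Const nat
  | Fst
  | Snd
  | Add
  | Sub
  | Fork expr expr
  | Comp expr expr
  | Sum expr
  | Prod expr

primrec ev :: "expr \<Rightarrow> nat \<Rightarrow> nat" where
  "ev (Const a) x = a"
| "ev Fst x = pr1 x"
| "ev Snd x = pr2 x"
| "ev Add x = pr1 x + pr2 x"
| "ev Sub x = pr1 x - pr2 x"
| "ev (Fork s t) x = pr (ev s x) (ev t x)"
| "ev (Comp s t) x = ev s (ev t x)"
| "ev (Sum s) x = (\<Sum>z<pr2 x. ev s (pr (pr1 x) z))"
| "ev (Prod s) x = (\<Prod>z<pr2 x. ev s (pr (pr1 x) z))"

text \<open>The first component tags the constructor. The padding by 0 puts a constant or a sole
  subterm at \<open>pr1 (pr2 c)\<close>, where the first of two subterms is also found.\<close>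

primrec code :: "expr \<Rightarrow> nat" where
  "code (Const a) = pr 0 (pr a 0)"
| "code Fst = pr 1 0"
| "code Snd = pr 2 0"
| "code Add = pr 3 0"
| "code Sub = pr 4 0"
| "code (Fork s t) = pr 5 (pr (code s) (code t))"
| "code (Comp s t) = pr 6 (pr (code s) (code t))"
| "code (Sum s) = pr 7 (pr (code s) 0)"
| "code (Prod s) = pr 8 (pr (code s) 0)"

abbreviation judgement :: "nat \<Rightarrow> nat \<Rightarrow> nat \<Rightarrow> nat" where
  "judgement c x y \<equiv> pr c (pr x y)"

text \<open>
  The bound \<open>b\<close> on the intermediate values only serves to make the predicate elementary.
\<close>

definition justified :: "nat set \<Rightarrow> nat \<Rightarrow> nat \<Rightarrow> nat \<Rightarrow> nat \<Rightarrow> bool" where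
  "justified A b c x y \<longleftrightarrow>
     pr1 c = 0 \<and> y = pr1 (pr2 c) \<or>
     pr1 c = 1 \<and> y = pr1 x \<or>
     pr1 c = 2 \<and> y = pr2 x \<or>
     pr1 c = 3 \<and> y = pr1 x + pr2 x \<or>
     pr1 c = 4 \<and> y = pr1 x - pr2 x \<or>
     pr1 c = 5 \<and> judgement (pr1 (pr2 c)) x (pr1 y) \<in> A \<and> judgement (pr2 (pr2 c)) x (pr2 y) \<in> A \<or>
     pr1 c = 6 \<and> (\<exists>u<b. judgement (pr2 (pr2 c)) x u \<in> A \<and> judgement (pr1 (pr2 c)) u y \<in> A) \<or>
     pr1 c = 7 \<and> (pr2 x = 0 \<and> y = 0 \<or>
       0 < pr2 x \<and> (\<exists>u<b. \<exists>v<b. judgement c (pr (pr1 x) (pr2 x - 1)) u \<in> A \<and>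
         judgement (pr1 (pr2 c)) (pr (pr1 x) (pr2 x - 1)) v \<in> A \<and> y = u + v)) \<or>
     pr1 c = 8 \<and> (pr2 x = 0 \<and> y = 1 \<or>
       0 < pr2 x \<and> (\<exists>u<b. \<exists>v<b. judgement c (pr (pr1 x) (pr2 x - 1)) u \<in> A \<and>
         judgement (pr1 (pr2 c)) (pr (pr1 x) (pr2 x - 1)) v \<in> A \<and> y = u * v))"

text \<open>Elements of \<open>set_decode w\<close> and the values they record are below
  \<open>w\<close>, so \<open>w\<close> itself can serve as the bound of all quantifiers.\<close>

definition derivation :: "nat \<Rightarrow> bool" where
  "derivation w \<longleftrightarrow>
     (\<forall>j<w. j \<in> set_decode w \<longrightarrow> justified (set_decode w) w (pr1 j) (pr1 (pr2 j)) (pr2 (pr2 j)))"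

lemma elementary_pred_derivation:
  "elementary f \<Longrightarrow> elementary_pred (\<lambda>x. derivation (f x))"
  unfolding elementary_pred_def
proof (rule elementary_comp[of "\<lambda>w. of_bool (derivation w)"])
  show "elementary (\<lambda>w. of_bool (derivation w))"
    unfolding derivation_def justified_def elementary_pred_def[symmetric]
    by (intro elementary_intros)
qed

section \<open>The universal function and soundness of derivations\<close>

text \<open>When \<open>c\<close> codes a term, soundness leaves at most one \<open>y\<close> with a
  derivation, so the sum returns that \<open>y\<close>, or 0 if the search below \<open>m\<close>
  fails.\<close>

definition universal :: "nat \<Rightarrow> nat \<Rightarrow> nat \<Rightarrow> nat" where
  "universal c x m =
     (\<Sum>y<m. y * of_bool (\<exists>w<m. derivation w \<and> judgement c x y \<in> set_decode w))"

lemma elementary_universal: "elementary (\<lambda>p. universal (pr1 p) (pr1 (pr2 p)) (pr2 (pr2 p)))"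
proof -
  have *: "elementary (\<lambda>x. f x * of_bool (P x))" if "elementary f" "elementary_pred P" for f P
    using that unfolding elementary_pred_def by (rule elementary_mult)
  show ?thesis
    unfolding universal_def
    by (intro * elementary_sum elementary_pred_derivation elementary_intros)
qed

lemma mem_set_decode_less: "j \<in> set_decode w \<Longrightarrow> j < w"
proof -
  assume "j \<in> set_decode w"
  then have "2 ^ j \<le> w"
    using mem_set_decode_iff[of j w] by auto
  then show "j < w" using less_exp[of j] by linarith
qed

lemma derivationD:
  "derivation w \<Longrightarrow> judgement c x y \<in> set_decode w \<Longrightarrow> justified (set_decode w) w c x y"
  unfolding derivation_def using mem_set_decode_less[of "judgement c x y" w]
  by (metis pr_simps(1,2))

text \<open>Although derivations are mere sets, reasoning cannot be circular: each rule leads to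
  proper subterms, or for \<open>Sum\<close> and \<open>Prod\<close> to the same term with a smaller
  bound, which an inner induction handles.\<close>

lemma derivation_sound:
  assumes "derivation w" "judgement (code t) x y \<in> set_decode w"
  shows "y = ev t x"
  using assms(2)
proof (induction t arbitrary: x y)
  case (Fork s t)
  then show ?case using derivationD[OF assms(1) Fork.prems]
    by (auto simp: justified_def)
next
  case (Comp s t)
  then show ?case using derivationD[OF assms(1) Comp.prems]
    by (auto simp: justified_def)
next
  case (Sum s)
  have "y = ev (Sum s) (pr a n)" if "judgement (code (Sum s)) (pr a n) y \<in> set_decode w" for a n y
    using that
  proof (induction n arbitrary: y)
    case 0
    then show ?case using derivationD[OF assms(1) 0] by (auto simp: justified_def)
  next
    case (Suc n)
    then show ?case using derivationD[OF assms(1) Suc.prems] Sum.IH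
      by (auto simp: justified_def)
  qed
  from this[of "pr1 x" "pr2 x"] Sum.prems show ?case by simp
next
  case (Prod s)
  have "y = ev (Prod s) (pr a n)" if "judgement (code (Prod s)) (pr a n) y \<in> set_decode w" for a n y
    using that
  proof (induction n arbitrary: y)
    case 0
    then show ?case using derivationD[OF assms(1) 0] by (auto simp: justified_def)
  next
    case (Suc n)
    then show ?case using derivationD[OF assms(1) Suc.prems] Prod.IH
      by (auto simp: justified_def)
  qed
  from this[of "pr1 x" "pr2 x"] Prod.prems show ?case by simp
qed (use derivationD[OF assms(1)] in \<open>auto simp: justified_def dest!: derivationD[OF assms(1)]\<close>)

subsection \<open>Bounds for derivations\<close>

text \<open>The first summand dominates pairing and squares, the second a product of at most
  \<open>m\<close> factors that are at most \<open>m\<close>. The base \<open>m + 2\<close> also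
  makes it dominate \<open>2 ^ m\<close>.\<close>

definition growth :: "nat \<Rightarrow> nat" where
  "growth m = pr m m + (m + 2) ^ m"

lemma growth_mono: "m \<le> n \<Longrightarrow> growth m \<le> growth n"
  unfolding growth_def
  using power_mono[of "m + 2" "n + 2" m] power_increasing[of m n "n + 2"] pr_mono[of m n m n]
  by linarith

lemma power2_le_growth: "2 ^ m \<le> growth m"
  using power_mono[of 2 "m + 2" m] by (simp add: growth_def)

lemma less_growth: "m < growth m"
  using power2_le_growth[of m] less_exp[of m] by linarith

lemma pr_le_growth: "x \<le> m \<Longrightarrow> y \<le> m \<Longrightarrow> pr x y \<le> growth m"
  using pr_mono[of x m y m] by (simp add: growth_def)

lemma funpow_growth_mono: "x \<le> y \<Longrightarrow> (growth ^^ k) x \<le> (growth ^^ k) y"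
  by (induction k) (auto intro: growth_mono)

lemma add_le_funpow_growth: "k + x \<le> (growth ^^ k) x"
proof (induction k)
  case (Suc k)
  then show ?case using less_growth[of "(growth ^^ k) x"] by simp
qed simp

lemma funpow_growth_mono_exponent:
  assumes "k \<le> l"
  shows "(growth ^^ k) x \<le> (growth ^^ l) x"
proof -
  have "(growth ^^ l) x = (growth ^^ (l - k)) ((growth ^^ k) x)"
    using assms by (simp flip: comp_apply[of "growth ^^ (l - k)" "growth ^^ k" x] funpow_add)
  then show ?thesis using add_le_funpow_growth[of "l - k" "(growth ^^ k) x"] by linarith
qed

text \<open>
  Set-valued functions cover both the values of a term and the judgements needed to derive them.
\<close>

definition tower_bounded :: "(nat \<Rightarrow> nat set) \<Rightarrow> bool" where
  "tower_bounded F \<longleftrightarrow> (\<exists>k. \<forall>x. \<forall>j\<in>F x. j \<le> (growth ^^ k) x)"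

lemma tower_boundedI: "(\<And>x j. j \<in> F x \<Longrightarrow> j \<le> (growth ^^ k) x) \<Longrightarrow> tower_bounded F"
  unfolding tower_bounded_def by blast

lemma tower_bounded_Un:
  assumes "tower_bounded F" "tower_bounded G"
  shows "tower_bounded (\<lambda>x. F x \<union> G x)"
proof -
  obtain k l where k: "\<And>x j. j \<in> F x \<Longrightarrow> j \<le> (growth ^^ k) x"
    and l: "\<And>x j. j \<in> G x \<Longrightarrow> j \<le> (growth ^^ l) x"
    using assms unfolding tower_bounded_def by blast
  show ?thesis
  proof (rule tower_boundedI[of _ "max k l"])
    fix x j assume "j \<in> F x \<union> G x"
    then have "j \<le> (growth ^^ k) x \<or> j \<le> (growth ^^ l) x"
      using k l by blast
    then show "j \<le> (growth ^^ max k l) x"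
      using funpow_growth_mono_exponent[of k "max k l" x]
        funpow_growth_mono_exponent[of l "max k l" x]
      by linarith
  qed
qed

text \<open>Composition adds the numbers of iterations, by monotonicity of \<open>growth\<close>;
  for singletons this is composition of functions.\<close>

lemma tower_bounded_UN:
  assumes F: "tower_bounded F" and G: "tower_bounded G"
  shows "tower_bounded (\<lambda>x. \<Union>y\<in>G x. F y)"
proof -
  obtain k l where k: "\<And>x j. j \<in> F x \<Longrightarrow> j \<le> (growth ^^ k) x"
    and l: "\<And>x j. j \<in> G x \<Longrightarrow> j \<le> (growth ^^ l) x"
    using assms unfolding tower_bounded_def by blast
  show ?thesis
  proof (rule tower_boundedI[of _ "k + l"])
    fix x j assume "j \<in> (\<Union>y\<in>G x. F y)"
    then obtain y where "y \<in> G x" "j \<in> F y" by blast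
    then have "j \<le> (growth ^^ k) y" "(growth ^^ k) y \<le> (growth ^^ k) ((growth ^^ l) x)"
      using k l funpow_growth_mono by auto
    then show "j \<le> (growth ^^ (k + l)) x" by (simp add: funpow_add)
  qed
qed

lemma tower_bounded_const: "tower_bounded (\<lambda>_. {c})"
proof (rule tower_boundedI[of _ c])
  fix x j :: nat assume "j \<in> {c}"
  then show "j \<le> (growth ^^ c) x" using add_le_funpow_growth[of c x] by simp
qed

lemma tower_bounded_le: "(\<And>x j. j \<in> F x \<Longrightarrow> j \<le> x) \<Longrightarrow> tower_bounded F"
  by (rule tower_boundedI[of _ 0]) simp

lemma tower_bounded_pr:
  assumes "tower_bounded (\<lambda>x. {f x})" "tower_bounded (\<lambda>x. {g x})"
  shows "tower_bounded (\<lambda>x. {pr (f x) (g x)})"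
proof -
  \<comment> \<open>The union provides one \<open>k\<close> for both components.\<close>
  have "tower_bounded (\<lambda>x. {f x} \<union> {g x})" by (intro tower_bounded_Un assms)
  then obtain k where k: "\<And>x. f x \<le> (growth ^^ k) x" "\<And>x. g x \<le> (growth ^^ k) x"
    unfolding tower_bounded_def by auto
  show ?thesis
    by (rule tower_boundedI[of _ "Suc k"]) (use k pr_le_growth in auto)
qed

text \<open>Common part of \<open>Sum\<close> and \<open>Prod\<close>: the arguments
  \<open>pr (pr1 x) z\<close> are at most \<open>x\<close>, so one \<open>m\<close> bounds all
  values of the body, and one further \<open>growth\<close> pays for adding or multiplying
  them.\<close>

lemma tower_bounded_iterated:
  assumes "tower_bounded (\<lambda>x. {f x})"
    and F: "\<And>x m. x \<le> m \<Longrightarrow> (\<And>z. z < pr2 x \<Longrightarrow> f (pr (pr1 x) z) \<le> m) \<Longrightarrow> F x \<le> growth m"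
  shows "tower_bounded (\<lambda>x. {F x})"
proof -
  obtain k where k: "\<And>x. f x \<le> (growth ^^ k) x"
    using assms(1) unfolding tower_bounded_def by auto
  show ?thesis
  proof (rule tower_boundedI[of _ "Suc k"])
    fix x j assume "j \<in> {F x}"
    moreover have "F x \<le> growth ((growth ^^ k) x)"
    proof (rule F)
      show "x \<le> (growth ^^ k) x" using add_le_funpow_growth[of k x] by linarith
      fix z assume "z < pr2 x"
      then have "pr (pr1 x) z \<le> x" using pr_mono[of "pr1 x" "pr1 x" z "pr2 x"] by simp
      then show "f (pr (pr1 x) z) \<le> (growth ^^ k) x"
        using k funpow_growth_mono le_trans by blast
    qed
    ultimately show "j \<le> (growth ^^ Suc k) x" by simp
  qed
qed

lemma add_le_pr: "x + y \<le> pr x y"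
proof -
  have "n \<le> triangle n" for n by (induction n) auto
  then show ?thesis unfolding pr_def prod_encode_def by (simp add: trans_le_add1)
qed

lemma mult_self_le_growth: "m * m \<le> growth m"
proof -
  have "n * n \<le> 2 * triangle n" for n by (induction n) auto
  from this[of "m + m"] show ?thesis
    by (simp add: growth_def pr_def prod_encode_def algebra_simps)
qed

lemma tower_bounded_ev: "tower_bounded (\<lambda>x. {ev t x})"
proof (induction t)
  case (Const a)
  then show ?case using tower_bounded_const by simp
next
  case Fst
  then show ?case using pr12_le by (intro tower_bounded_le) auto
next
  case Snd
  then show ?case using pr12_le by (intro tower_bounded_le) auto
next
  case Add
  have "pr1 x + pr2 x \<le> x" for x using add_le_pr[of "pr1 x" "pr2 x"] by simp
  then show ?case by (intro tower_bounded_le) auto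
next
  case Sub
  have "pr1 x - pr2 x \<le> x" for x using pr12_le(1)[of x] by linarith
  then show ?case by (intro tower_bounded_le) auto
next
  case (Fork s t)
  then show ?case using tower_bounded_pr by simp
next
  case (Comp s t)
  then show ?case using tower_bounded_UN[OF Comp] by simp
next
  case (Sum s)
  then show ?case
  proof (rule tower_bounded_iterated)
    fix x m assume *: "x \<le> m" "\<And>z. z < pr2 x \<Longrightarrow> ev s (pr (pr1 x) z) \<le> m"
    have "ev (Sum s) x \<le> pr2 x * m"
      using sum_bounded_above[of "{..<pr2 x}" "\<lambda>z. ev s (pr (pr1 x) z)" m] * by simp
    also have "\<dots> \<le> m * m" using *(1) pr12_le(2)[of x] by (intro mult_le_mono) auto
    finally show "ev (Sum s) x \<le> growth m" using mult_self_le_growth[of m] by linarith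
  qed
next
  case (Prod s)
  then show ?case
  proof (rule tower_bounded_iterated)
    fix x m assume *: "x \<le> m" "\<And>z. z < pr2 x \<Longrightarrow> ev s (pr (pr1 x) z) \<le> m"
    \<comment> \<open>Raising each factor to \<open>m + 2\<close>, which is positive, makes the
      power monotone in the number of factors.\<close>
    have "ev (Prod s) x \<le> (\<Prod>z<pr2 x. m + 2)"
      using *(2) unfolding ev.simps by (intro prod_mono) (simp add: le_SucI)
    also have "\<dots> \<le> (m + 2) ^ m"
      using *(1) pr12_le(2)[of x] by (simp add: power_increasing)
    finally show "ev (Prod s) x \<le> growth m" by (simp add: growth_def)
  qed
qed

section \<open>A complete derivation of each value\<close>

abbreviation truth :: "expr \<Rightarrow> nat \<Rightarrow> nat" where
  "truth t x \<equiv> judgement (code t) x (ev t x)"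

text \<open>All judgements of one derivation of \<open>ev t x\<close>. For \<open>Sum\<close> and
  \<open>Prod\<close> these include every partial result, from the empty one at bound 0 up to bound
  \<open>pr2 x\<close>.\<close>

primrec needed :: "expr \<Rightarrow> nat \<Rightarrow> nat set" where
  "needed (Const a) x = {truth (Const a) x}"
| "needed Fst x = {truth Fst x}"
| "needed Snd x = {truth Snd x}"
| "needed Add x = {truth Add x}"
| "needed Sub x = {truth Sub x}"
| "needed (Fork s t) x = {truth (Fork s t) x} \<union> (needed s x \<union> needed t x)"
| "needed (Comp s t) x = {truth (Comp s t) x} \<union> (needed s (ev t x) \<union> needed t x)"
| "needed (Sum s) x = (\<Union>z\<in>pr (pr1 x) ` {..pr2 x}. {truth (Sum s) z}) \<union>
     (\<Union>z\<in>pr (pr1 x) ` {..<pr2 x}. needed s z)"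
| "needed (Prod s) x = (\<Union>z\<in>pr (pr1 x) ` {..pr2 x}. {truth (Prod s) z}) \<union>
     (\<Union>z\<in>pr (pr1 x) ` {..<pr2 x}. needed s z)"

lemma finite_needed: "finite (needed t x)"
  by (induction t arbitrary: x) auto

lemma truth_in_needed: "truth t x \<in> needed t x"
proof -
  have "x \<in> pr (pr1 x) ` {..pr2 x}" by (rule image_eqI[of _ _ "pr2 x"]) simp_all
  then show ?thesis by (cases t) (simp_all only: needed.simps, blast+)
qed

lemma tower_bounded_truth: "tower_bounded (\<lambda>x. {truth t x})"
  by (intro tower_bounded_pr tower_bounded_const tower_bounded_ev tower_bounded_le) simp

lemma tower_bounded_args:
  assumes "\<And>n. A n \<subseteq> {..n}"
  shows "tower_bounded (\<lambda>x. pr (pr1 x) ` A (pr2 x))"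
proof (rule tower_bounded_le)
  fix x j assume "j \<in> pr (pr1 x) ` A (pr2 x)"
  then obtain z where "j = pr (pr1 x) z" "z \<le> pr2 x" using assms by blast
  then show "j \<le> x" using pr_mono[of "pr1 x" "pr1 x" z "pr2 x"] by simp
qed

lemma tower_bounded_needed: "tower_bounded (needed t)"
proof (induction t)
  case (Fork s t)
  then show ?case unfolding needed.simps by (intro tower_bounded_Un tower_bounded_truth)
next
  case (Comp s t)
  have "tower_bounded (\<lambda>x. \<Union>y\<in>{ev t x}. needed s y)"
    by (intro tower_bounded_UN Comp tower_bounded_ev)
  then have "tower_bounded (\<lambda>x. needed s (ev t x))" by simp
  with Comp show ?case unfolding needed.simps by (intro tower_bounded_Un tower_bounded_truth)
next
  case (Sum s)
  then show ?case unfolding needed.simps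
    by (intro tower_bounded_Un tower_bounded_UN tower_bounded_truth tower_bounded_args) auto
next
  case (Prod s)
  then show ?case unfolding needed.simps
    by (intro tower_bounded_Un tower_bounded_UN tower_bounded_truth tower_bounded_args) auto
qed (simp_all only: needed.simps tower_bounded_truth)

text \<open>The bound on intermediate values may vary with the judgement, so that sets can be
  assembled before the number coding them is known.\<close>

definition valid :: "nat set \<Rightarrow> bool" where
  "valid A \<longleftrightarrow> (\<forall>j\<in>A. \<exists>b. justified A b (pr1 j) (pr1 (pr2 j)) (pr2 (pr2 j)))"

text \<open>The set occurs only positively in the rules; hence unions of valid sets are
  valid.\<close>

lemma justified_mono:
  assumes "justified A b c x y" "A \<subseteq> A'"
  shows "justified A' b c x y"
  using assms(1) unfolding justified_def
  by (elim disj_forward) (blast dest: subsetD[OF assms(2)])+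

text \<open>Every intermediate value quantified in a rule is the value of some judgement in
  \<open>A\<close>, so any strict bound on those values will do.\<close>

lemma justified_bound:
  assumes "justified A b c x y" "\<And>c x y. judgement c x y \<in> A \<Longrightarrow> y < b'"
  shows "justified A b' c x y"
  using assms(1) unfolding justified_def
  by (elim disj_forward) (blast dest: assms(2))+

lemma valid_Un: "valid A \<Longrightarrow> valid B \<Longrightarrow> valid (A \<union> B)"
  unfolding valid_def using justified_mono[of A _ _ _ _ "A \<union> B"] justified_mono[of B _ _ _ _ "A \<union> B"]
  by blast

lemma valid_UN: "(\<And>i. i \<in> I \<Longrightarrow> valid (A i)) \<Longrightarrow> valid (\<Union>i\<in>I. A i)"
  unfolding valid_def using justified_mono[of "A _" _ _ _ _ "\<Union>i\<in>I. A i"]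
  by blast

lemma valid_extend:
  assumes "valid A" "\<And>j. j \<in> B \<Longrightarrow> \<exists>b. justified (B \<union> A) b (pr1 j) (pr1 (pr2 j)) (pr2 (pr2 j))"
  shows "valid (B \<union> A)"
  using assms justified_mono[of A _ _ _ _ "B \<union> A"] unfolding valid_def by blast

text \<open>Common part of \<open>Sum\<close> and \<open>Prod\<close>: the partial result at
  \<open>Suc n\<close> follows from the one at \<open>n\<close> and the value of the body at
  \<open>n\<close>.\<close>

lemma valid_iterated:
  fixes F :: "nat \<Rightarrow> nat" and s x c
  defines "B \<equiv> (\<Union>z\<in>pr (pr1 x) ` {..pr2 x}. {judgement c z (F z)})"
    and "A \<equiv> (\<Union>z\<in>pr (pr1 x) ` {..<pr2 x}. needed s z)"
  assumes needed: "\<And>z. valid (needed s z)"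
    and step0: "\<And>D a. \<exists>b. justified D b c (pr a 0) (F (pr a 0))"
    and step: "\<And>D a n. judgement c (pr a n) (F (pr a n)) \<in> D \<Longrightarrow> truth s (pr a n) \<in> D \<Longrightarrow>
      \<exists>b. justified D b c (pr a (Suc n)) (F (pr a (Suc n)))"
  shows "valid (B \<union> A)"
proof (rule valid_extend)
  show "valid A" unfolding A_def by (intro valid_UN needed)
  fix j assume "j \<in> B"
  then obtain n where n: "n \<le> pr2 x" "j = judgement c (pr (pr1 x) n) (F (pr (pr1 x) n))"
    unfolding B_def by blast
  have "\<exists>b. justified (B \<union> A) b c (pr (pr1 x) n) (F (pr (pr1 x) n))"
  proof (cases n)
    case 0
    then show ?thesis using step0 by simp
  next
    case (Suc m)
    then have m: "m \<in> {..pr2 x}" "m \<in> {..<pr2 x}" using n(1) by auto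
    have "judgement c (pr (pr1 x) m) (F (pr (pr1 x) m)) \<in> B"
      unfolding B_def using m(1) by blast
    moreover have "truth s (pr (pr1 x) m) \<in> A"
      unfolding A_def using m(2) truth_in_needed[of s "pr (pr1 x) m"] by blast
    ultimately
    show ?thesis using step[of "pr1 x" m "B \<union> A"] Suc by simp
  qed
  then show "\<exists>b. justified (B \<union> A) b (pr1 j) (pr1 (pr2 j)) (pr2 (pr2 j))"
    using n(2) by simp
qed

lemma valid_needed: "valid (needed t x)"
proof (induction t arbitrary: x)
  case (Fork s t)
  show ?case unfolding needed.simps
    by (rule valid_extend[OF valid_Un[OF Fork]]) (auto simp: justified_def truth_in_needed)
next
  case (Comp s t)
  show ?case unfolding needed.simps
  proof (rule valid_extend[OF valid_Un[OF Comp]])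
    fix j assume "j \<in> {truth (Comp s t) x}"
    then show "\<exists>b. justified ({truth (Comp s t) x} \<union> (needed s (ev t x) \<union> needed t x)) b
        (pr1 j) (pr1 (pr2 j)) (pr2 (pr2 j))"
      using truth_in_needed[of s "ev t x"] truth_in_needed[of t x]
      \<comment> \<open>The intermediate value is \<open>ev t x\<close>, and the bound is
        strict.\<close>
      by (intro exI[of _ "ev t x + 1"]) (auto simp: justified_def)
  qed
next
  case (Sum s)
  show ?case unfolding needed.simps
  proof (rule valid_iterated[OF Sum])
    fix D a n
    show "\<exists>b. justified D b (code (Sum s)) (pr a 0) (ev (Sum s) (pr a 0))"
      by (simp add: justified_def)
    assume "judgement (code (Sum s)) (pr a n) (ev (Sum s) (pr a n)) \<in> D" "truth s (pr a n) \<in> D"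
    then show "\<exists>b. justified D b (code (Sum s)) (pr a (Suc n)) (ev (Sum s) (pr a (Suc n)))"
      by (intro exI[of _ "ev (Sum s) (pr a n) + ev s (pr a n) + 1"])
        (simp add: justified_def less_Suc_eq_le, blast intro: le_add1 le_add2)
  qed
next
  case (Prod s)
  show ?case unfolding needed.simps
  proof (rule valid_iterated[OF Prod])
    fix D a n
    show "\<exists>b. justified D b (code (Prod s)) (pr a 0) (ev (Prod s) (pr a 0))"
      by (simp add: justified_def)
    assume "judgement (code (Prod s)) (pr a n) (ev (Prod s) (pr a n)) \<in> D" "truth s (pr a n) \<in> D"
    then show "\<exists>b. justified D b (code (Prod s)) (pr a (Suc n)) (ev (Prod s) (pr a (Suc n)))"
      \<comment> \<open>The bound must exceed both factors. Their sum plus 1 does so even if one of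
        them is 0.\<close>
      by (intro exI[of _ "ev (Prod s) (pr a n) + ev s (pr a n) + 1"])
        (simp add: justified_def less_Suc_eq_le, blast intro: le_add1 le_add2)
  qed
qed (simp_all add: valid_def justified_def)

lemma derivation_set_encode:
  assumes "finite A" "valid A"
  shows "derivation (set_encode A)"
  unfolding derivation_def set_encode_inverse[OF assms(1)]
proof (intro allI impI)
  have *: "y < set_encode A" if "judgement c x y \<in> A" for c x y
  proof -
    have "judgement c x y < set_encode A"
      using that mem_set_decode_less set_encode_inverse[OF assms(1)] by auto
    then show ?thesis using le_pr(2)[of y x] le_pr(2)[of "pr x y" c] by linarith
  qed
  fix j assume "j \<in> A"
  then obtain b where "justified A b (pr1 j) (pr1 (pr2 j)) (pr2 (pr2 j))"
    using assms(2) unfolding valid_def by blast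
  then show "justified A (set_encode A) (pr1 j) (pr1 (pr2 j)) (pr2 (pr2 j))"
    by (rule justified_bound) (rule *)
qed

lemma derivation_complete:
  "\<exists>k. \<forall>x. \<exists>w<(growth ^^ k) x. derivation w \<and> truth t x \<in> set_decode w"
proof -
  obtain k where k: "\<And>x j. j \<in> needed t x \<Longrightarrow> j \<le> (growth ^^ k) x"
    using tower_bounded_needed[of t] unfolding tower_bounded_def by blast
  have "set_encode (needed t x) < (growth ^^ (k + 2)) x" for x
  proof -
    let ?n = "(growth ^^ k) x"
    \<comment> \<open>A set of numbers at most \<open>n\<close> has a code below
      \<open>2 ^ Suc n\<close>. Two applications of \<open>growth\<close> absorb this: one for the
      successor, one for the power.\<close>
    have "set_encode (needed t x) \<le> set_encode {0..<Suc ?n}"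
      unfolding set_encode_def using k[of _ x] by (intro sum_mono2) (auto simp: less_Suc_eq_le)
    also have "\<dots> < 2 ^ Suc ?n"
      by (simp only: set_encode_def sum_power2) simp
    also have "\<dots> \<le> growth (growth ?n)"
      using power2_le_growth[of "Suc ?n"] growth_mono[of "Suc ?n" "growth ?n"] less_growth[of ?n]
      by linarith
    finally show ?thesis by simp
  qed
  moreover have "derivation (set_encode (needed t x))"
    "truth t x \<in> set_decode (set_encode (needed t x))" for x
    by (simp_all add: derivation_set_encode finite_needed valid_needed truth_in_needed)
  ultimately show ?thesis by blast
qed

text \<open>Completeness puts some derivation below the bound, and soundness makes its value the
  only one. The number \<open>k\<close> depends on \<open>t\<close> alone, which makes the right
  side a fixed composition.\<close>

lemma ev_universal: "\<exists>k. \<forall>x. ev t x = universal (code t) x ((growth ^^ k) x)"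
proof -
  obtain k where k: "\<And>x. \<exists>w<(growth ^^ k) x. derivation w \<and> truth t x \<in> set_decode w"
    using derivation_complete by blast
  have "ev t x = universal (code t) x ((growth ^^ k) x)" for x
  proof -
    obtain w where w: "w < (growth ^^ k) x" "derivation w" "truth t x \<in> set_decode w"
      using k by blast
    have iff: "(\<exists>w<(growth ^^ k) x. derivation w \<and> judgement (code t) x y \<in> set_decode w) \<longleftrightarrow> y = ev t x"
      for y using w derivation_sound by blast
    have "ev t x < (growth ^^ k) x"
      using mem_set_decode_less[OF w(3)] w(1) le_pr(2)[of "ev t x" x]
        le_pr(2)[of "pr x (ev t x)" "code t"] by linarith
    then have "(\<Sum>y<(growth ^^ k) x. y * of_bool (y = ev t x)) = ev t x"
      by (simp add: of_bool_def if_distrib cong: if_cong)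
    then show ?thesis unfolding universal_def iff by simp
  qed
  then show ?thesis by blast
qed

subsection \<open>The single basis operation\<close>

text \<open>Nesting to the left puts the last argument outermost, so a code is already the pair of
  parameters and bound that \<open>Sum\<close> and \<open>Prod\<close> expect.\<close>

definition encode :: "nat list \<Rightarrow> nat" where "encode = foldl pr 0"

lemma encode_snoc [simp]: "encode (xs @ [x]) = pr (encode xs) x"
  by (simp add: encode_def)

lemma encode_eq_pr: "length xs = Suc n \<Longrightarrow> encode xs = pr (encode (butlast xs)) (last xs)"
  by (cases xs rule: rev_cases) simp_all

definition expressible :: "operation set" where
  "expressible = {(n, f) \<in> operations. \<exists>t. \<forall>xs. length xs = n \<longrightarrow> f xs = ev t (encode xs)}"

lemma expressibleI:
  assumes "1 \<le> n" "\<And>xs. length xs = n \<Longrightarrow> f xs = ev t (encode xs)"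
  shows "op_of n f \<in> expressible"
  using assms op_of_in_operations[of n f]
  by (auto simp: expressible_def op_of_def tuples_def)

lemma expressibleE:
  assumes "(n, f) \<in> expressible"
  obtains t where "1 \<le> n" "\<And>xs. length xs = n \<Longrightarrow> f xs = ev t (encode xs)"
  using assms by (auto simp: expressible_def operations_def)

text \<open>\<open>Snd\<close> reads the last entry and \<open>Fst\<close> drops it.\<close>

lemma ex_expr_nth: "i < n \<Longrightarrow> \<exists>t. \<forall>xs. length xs = n \<longrightarrow> xs ! i = ev t (encode xs)"
proof (induction n)
  case (Suc n)
  show ?case
  proof (cases "i = n")
    case True
    have "xs ! i = ev Snd (encode xs)" if "length xs = Suc n" for xs
      using that True by (cases xs rule: rev_cases) auto
    then show ?thesis by blast
  next
    case False
    then obtain t where t: "\<And>xs. length xs = n \<Longrightarrow> xs ! i = ev t (encode xs)"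
      using Suc by (auto simp: less_Suc_eq)
    have "xs ! i = ev (Comp t Fst) (encode xs)" if "length xs = Suc n" for xs
      using that t False Suc.prems
      by (cases xs rule: rev_cases) (auto simp: nth_append)
    then show ?thesis by blast
  qed
qed simp

lemma ex_expr_map:
  assumes "\<And>g. g \<in> set gs \<Longrightarrow> (n, g) \<in> expressible"
  shows "\<exists>t. \<forall>xs. length xs = n \<longrightarrow> encode (map (\<lambda>g. g xs) gs) = ev t (encode xs)"
  using assms
proof (induction gs rule: rev_induct)
  case Nil
  show ?case by (rule exI[of _ "Const 0"]) (simp add: encode_def)
next
  case (snoc g gs)
  then obtain t where "\<And>xs. length xs = n \<Longrightarrow> encode (map (\<lambda>g. g xs) gs) = ev t (encode xs)"
    by auto
  moreover obtain s where "\<And>xs. length xs = n \<Longrightarrow> g xs = ev s (encode xs)"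
    using snoc.prems[of g] by (auto elim: expressibleE)
  ultimately show ?case by (intro exI[of _ "Fork t s"]) simp
qed

lemma closed_under_substitution_expressible: "closed_under_substitution expressible"
  unfolding closed_under_substitution_def
proof (intro allI impI)
  fix r f n and gs :: "(nat list \<Rightarrow> nat) list"
  assume *: "(r, f) \<in> expressible \<and> length gs = r \<and> (\<forall>g\<in>set gs. (n, g) \<in> expressible)"
  then obtain s where s: "1 \<le> r" "\<And>xs. length xs = r \<Longrightarrow> f xs = ev s (encode xs)"
    using expressibleE[of r f] by metis
  obtain t where t: "\<And>xs. length xs = n \<Longrightarrow> encode (map (\<lambda>g. g xs) gs) = ev t (encode xs)"
    using ex_expr_map[of gs n] * by blast
  have "gs \<noteq> []" using * s(1) by auto
  then have "1 \<le> n" using * by (cases gs) (auto elim: expressibleE)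
  then show "op_of n (\<lambda>xs. f (map (\<lambda>g. g xs) gs)) \<in> expressible"
    using s(2) t * by (intro expressibleI[where t = "Comp s t"]) auto
qed

lemma closed_under_bounded_expressible:
  "closed_under_bounded_sum expressible" "closed_under_bounded_prod expressible"
  unfolding closed_under_bounded_sum_def closed_under_bounded_prod_def
proof safe
  fix n f assume "(Suc n, f) \<in> expressible"
  then obtain t where t: "\<And>xs. length xs = Suc n \<Longrightarrow> f xs = ev t (encode xs)"
    using expressibleE by metis
  show "op_of (Suc n) (\<lambda>xs. \<Sum>z<last xs. f (butlast xs @ [z])) \<in> expressible"
    using t by (intro expressibleI[where t = "Sum t"]) (auto simp: encode_eq_pr)
  show "op_of (Suc n) (\<lambda>xs. \<Prod>z<last xs. f (butlast xs @ [z])) \<in> expressible"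
    using t by (intro expressibleI[where t = "Prod t"]) (auto simp: encode_eq_pr)
qed

lemma kalmar_elementary_subset_expressible: "kalmar_elementary \<subseteq> expressible"
  unfolding kalmar_elementary_def
proof (rule hull_minimal)
  have "constant_ops \<subseteq> expressible"
    by (auto simp: constant_ops_def intro!: expressibleI[where t = "Const _"])
  moreover have "projection_ops \<subseteq> expressible"
  proof
    fix p assume "p \<in> projection_ops"
    then obtain n i where p: "p = op_of n (\<lambda>xs. xs ! i)" "i < n"
      by (auto simp: projection_ops_def)
    from ex_expr_nth[OF p(2)] obtain t where "\<And>xs. length xs = n \<Longrightarrow> xs ! i = ev t (encode xs)"
      by blast
    then show "p \<in> expressible" unfolding p(1) using p(2) by (intro expressibleI) auto
  qed
  \<comment> \<open>A list of two entries is coded as \<open>pr (pr 0 x) y\<close>, so its entries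
    have to be repacked as \<open>pr x y\<close> before \<open>t\<close> is applied.\<close>
  moreover have "binary_op f \<in> expressible" if "\<And>x. ev t x = f (pr1 x) (pr2 x)" for f t
  proof -
    obtain s where s: "\<And>xs. length xs = 2 \<Longrightarrow> xs ! 0 = ev s (encode xs)"
      using ex_expr_nth[of 0 2] by auto
    obtain s' where s': "\<And>xs. length xs = 2 \<Longrightarrow> xs ! 1 = ev s' (encode xs)"
      using ex_expr_nth[of 1 2] by auto
    show ?thesis
      unfolding binary_op_def
      using s s' that by (intro expressibleI[where t = "Comp t (Fork s s')"]) auto
  qed
  from this[of Add "\<lambda>x y. x + y"] this[of Sub "\<lambda>x y. x - y"]
  have "binary_op (\<lambda>x y. x + y) \<in> expressible" "binary_op (\<lambda>x y. x - y) \<in> expressible"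
    by simp_all
  ultimately show "constant_ops \<union> projection_ops \<union>
      {binary_op (\<lambda>x y. x + y), binary_op (\<lambda>x y. x - y)} \<subseteq> expressible"
    by blast
qed (simp add: closed_under_substitution_expressible closed_under_bounded_expressible)

text \<open>
  The shift by 3 keeps the first arguments 0, 1, 2 free as selectors: pairing is recovered as
  \<open>pr x y = basis (basis 0 x) y\<close>.
\<close>

definition basis :: "nat \<Rightarrow> nat \<Rightarrow> nat" where
  "basis x y =
     (if x = 0 then y + 3
      else if x = 1 then growth y
      else if x = 2 then universal (pr1 y) (pr1 (pr2 y)) (pr2 (pr2 y))
      else pr (x - 3) y)"

lemma basis_simps:
  "basis 0 y = y + 3" "basis (Suc 0) y = growth y" "basis (x + 3) y = pr x y"
  "basis 2 y = universal (pr1 y) (pr1 (pr2 y)) (pr2 (pr2 y))"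
  by (simp_all add: basis_def)

lemma basis_elementary: "binary_op basis \<in> kalmar_elementary"
proof (rule elementary_curried)
  have *: "elementary (\<lambda>p. universal (pr1 (f p)) (pr1 (pr2 (f p))) (pr2 (pr2 (f p))))"
    if "elementary f" for f
    by (rule elementary_comp[OF elementary_universal that])
  show "elementary (\<lambda>p. basis (pr1 p) (pr2 p))"
    unfolding basis_def growth_def by (intro elementary_intros *)
qed

lemma substitution_closure_basis_subset:
  "substitution_closure {binary_op basis} \<subseteq> kalmar_elementary"
  unfolding substitution_closure_def
  using basis_elementary kalmar_basic kalmar_elementary_closed by (intro hull_minimal) auto

section \<open>Recovering all elementary operations from \<open>basis\<close>\<close>

interpretation B: clone "substitution_closure {binary_op basis}"
  by (rule clone_substitution_closure)

lemma op_basis: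
  assumes "op_of n f \<in> substitution_closure {binary_op basis}"
    and "op_of n g \<in> substitution_closure {binary_op basis}"
  shows "op_of n (\<lambda>xs. basis (f xs) (g xs)) \<in> substitution_closure {binary_op basis}"
proof (rule B.op_subst2[OF _ assms])
  show "binary_op basis \<in> substitution_closure {binary_op basis}"
    unfolding substitution_closure_def
    using hull_subset[of "{binary_op basis} \<union> constant_ops \<union> projection_ops"] by blast
qed

lemma basis_pr: "op_of n f \<in> substitution_closure {binary_op basis} \<Longrightarrow>
    op_of n g \<in> substitution_closure {binary_op basis} \<Longrightarrow> 1 \<le> n \<Longrightarrow>
    op_of n (\<lambda>xs. pr (f xs) (g xs)) \<in> substitution_closure {binary_op basis}"
  using op_basis[OF op_basis[OF B.op_const[of n 0]], of f g] by (simp add: basis_simps)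

lemma basis_growth:
  assumes "op_of n f \<in> substitution_closure {binary_op basis}" "1 \<le> n"
  shows "op_of n (\<lambda>xs. (growth ^^ k) (f xs)) \<in> substitution_closure {binary_op basis}"
proof (induction k)
  case (Suc k)
  then show ?case
    using op_basis[OF B.op_const[of n 1], of "\<lambda>xs. (growth ^^ k) (f xs)"] assms(2)
    by (simp add: basis_simps)
qed (use assms in simp)

lemma basis_encode:
  assumes "1 \<le> n"
  shows "op_of n encode \<in> substitution_closure {binary_op basis}"
proof -
  have "op_of n (\<lambda>xs. encode (take m xs)) \<in> substitution_closure {binary_op basis}" if "m \<le> n" for m
    using that
  proof (induction m)
    case 0
    then show ?case using B.op_const[OF assms] by simp
  next
    case (Suc m)
    then have "op_of n (\<lambda>xs. pr (encode (take m xs)) (xs ! m)) \<in>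
        substitution_closure {binary_op basis}"
      using assms by (intro basis_pr B.op_proj) auto
    also have "op_of n (\<lambda>xs. pr (encode (take m xs)) (xs ! m)) =
        op_of n (\<lambda>xs. encode (take (Suc m) xs))"
      using Suc.prems by (intro op_of_cong) (simp add: take_Suc_conv_app_nth)
    finally show ?case .
  qed
  from this[of n] have "op_of n (\<lambda>xs. encode (take n xs)) \<in> substitution_closure {binary_op basis}"
    by simp
  also have "op_of n (\<lambda>xs. encode (take n xs)) = op_of n encode"
    by (rule op_of_cong) simp
  finally show ?thesis .
qed

text \<open>Selector 2 applies \<open>universal\<close> to the code of a term, the coded arguments
  and an iterate of \<open>growth\<close>. The code and the number of iterations are fixed by the
  term, so they enter as a constant and as the depth of the composition.\<close>

lemma expressible_subset: "expressible \<subseteq> substitution_closure {binary_op basis}"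
proof
  fix p assume p: "p \<in> expressible"
  then obtain n f t where nf: "p = (n, f)" "1 \<le> n" "\<And>xs. length xs = n \<Longrightarrow> f xs = ev t (encode xs)"
    by (cases p) (auto elim: expressibleE)
  have "f \<in> extensional (tuples n)"
    using p unfolding nf(1) expressible_def operations_def by (auto simp: PiE_def)
  \<comment> \<open>Equality of pairs also demands agreement off the lists of length
    \<open>n\<close>, which extensionality supplies.\<close>
  then have "p = op_of n f"
    unfolding nf(1) op_of_def by (simp add: extensional_restrict)
  obtain k where k: "\<And>x. ev t x = universal (code t) x ((growth ^^ k) x)"
    using ev_universal by blast
  have "op_of n (\<lambda>xs. basis 2 (judgement (code t) (encode xs) ((growth ^^ k) (encode xs)))) \<in>
      substitution_closure {binary_op basis}"
    by (intro op_basis basis_pr basis_growth basis_encode B.op_const nf(2))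
  also have "op_of n (\<lambda>xs. basis 2 (judgement (code t) (encode xs) ((growth ^^ k) (encode xs)))) =
      op_of n f"
    using nf(3) k by (intro op_of_cong) (simp add: basis_simps)
  finally show "p \<in> substitution_closure {binary_op basis}"
    using \<open>p = op_of n f\<close> by simp
qed

theorem theorem18:
  shows "\<exists>h :: nat \<Rightarrow> nat \<Rightarrow> nat. substitution_basis {binary_op h} kalmar_elementary"
proof (intro exI)
  show "substitution_basis {binary_op basis} kalmar_elementary"
    using kalmar_elementary_subset_expressible expressible_subset
      substitution_closure_basis_subset
    by (auto simp: substitution_basis_def binary_op_in_operations)
qed

end
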